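(* Let $\alpha,\beta>0$ and let the prior on the basin size $s\in[0,1]$ be $\Pi=\operatorname{Beta}(\alpha,\beta)$. For $n\ge 1$ let $H_n$ be the event that $n$ runs, which conditionally on $s$ are independent and each reach the fixed outcome $x^*$ with probability $s$, all reach $x^*$. Then the posterior distribution of $s$ given $H_n$ is $\operatorname{Beta}(\alpha+n,\beta)$. Moreover the posterior concentrates around $1$ exponentially fast in $n$: for every $\varepsilon\in(0,1)$ and every $n\ge 1$, $$\Pi\left(s\le 1-\varepsilon \mid H_n\right)\le \frac{(\alpha+n+\beta)^{\beta}}{\Gamma(\beta+1)}\,(1-\varepsilon)^{\alpha+n-1}.$$
   Context: The likelihood is $\mathbb P(H_n\mid s)=s^n$, so for Borel $A\subseteq[0,1]$ the posterior is $\Pi(A\mid H_n)=\int_A s^n\,d\Pi(s)\big/\int_{[0,1]} s^n\,d\Pi(s)$. $\Gamma$ is the Gamma function and $\operatorname{Beta}(\alpha,\beta)$ has density proportional to $s^{\alpha-1}(1-s)^{\beta-1}$ on $(0,1)$. *)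

theory Defs
  imports "HOL-Probability.Probability"
begin

definition beta_density :: "real \<Rightarrow> real \<Rightarrow> real \<Rightarrow> real" where
  "beta_density a b s =
     (if 0 < s \<and> s < 1 then s powr (a - 1) * (1 - s) powr (b - 1) / Beta a b else 0)"

text \<open>
  The Beta law is a Borel measure on the real line that is concentrated on the open unit interval.
\<close>

definition beta_measure :: "real \<Rightarrow> real \<Rightarrow> real measure" where
  "beta_measure a b = density lborel (\<lambda>s. ennreal (beta_density a b s))"

lemma prob_space_beta_measure:
  assumes "a > 0" "b > 0"
  shows "prob_space (beta_measure a b)"
proof
  have B: "Beta a b > 0"
    using assms by (simp add: Beta_def Gamma_real_pos)
  have "((\<lambda>t. t powr (a - 1) * (1 - t) powr (b - 1)) has_integral Beta a b) {0<..<1}"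
    using has_integral_Beta_real[of a b] assms by (simp add: has_integral_Icc_iff_Ioo)
  from has_integral_divide[OF this, of "Beta a b"]
  have "((\<lambda>t. t powr (a - 1) * (1 - t) powr (b - 1) / Beta a b) has_integral 1) {0<..<1}"
    using B by simp
  then have "((\<lambda>t. if t \<in> {0<..<1} then t powr (a - 1) * (1 - t) powr (b - 1) / Beta a b else 0)
      has_integral 1) UNIV"
    by (simp only: has_integral_restrict_UNIV)
  then have "(beta_density a b has_integral 1) UNIV"
    by (rule has_integral_cong[THEN iffD1, rotated]) (auto simp: beta_density_def)
  moreover have "beta_density a b \<in> borel_measurable borel"
    unfolding beta_density_def by measurable
  moreover have "beta_density a b x \<ge> 0" for x
    using B by (simp add: beta_density_def)
  ultimately have "(\<integral>\<^sup>+ x. ennreal (beta_density a b x) \<partial>lborel) = ennreal 1"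
    by (intro nn_integral_has_integral_lborel) auto
  then show "emeasure (beta_measure a b) (space (beta_measure a b)) = 1"
    using \<open>beta_density a b \<in> borel_measurable borel\<close>
    by (simp add: beta_measure_def emeasure_density)
qed

definition gen_sigma :: "'w measure \<Rightarrow> ('w \<Rightarrow> real) \<Rightarrow> 'w measure" where
  "gen_sigma M S = vimage_algebra (space M) S borel"

text \<open>
  Conditional independence, given the sub-sigma-algebra \<open>F\<close>, of the \<open>N\<close>-valued random variables
  \<open>X i\<close> for \<open>i \<in> I\<close>: conditional probabilities are conditional expectations of indicators.
\<close>

definition cond_indep_vars ::
    "'w measure \<Rightarrow> 'w measure \<Rightarrow> 'x measure \<Rightarrow> ('i \<Rightarrow> 'w \<Rightarrow> 'x) \<Rightarrow> 'i set \<Rightarrow> bool" where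
  "cond_indep_vars M F N X I \<longleftrightarrow>
     (\<forall>i\<in>I. X i \<in> measurable M N) \<and>
     (\<forall>J B. J \<subseteq> I \<longrightarrow> finite J \<longrightarrow> (\<forall>j\<in>J. B j \<in> sets N) \<longrightarrow>
       (AE w in M. real_cond_exp M F (\<lambda>w. \<Prod>j\<in>J. indicator (B j) (X j w)) w
                 = (\<Prod>j\<in>J. real_cond_exp M F (\<lambda>w. indicator (B j) (X j w)) w)))"

definition all_reach :: "'w measure \<Rightarrow> (nat \<Rightarrow> 'w \<Rightarrow> 'x) \<Rightarrow> 'x \<Rightarrow> nat \<Rightarrow> 'w set" where
  "all_reach M X xstar n = {w \<in> space M. \<forall>i<n. X i w = xstar}"

definition posterior :: "'w measure \<Rightarrow> ('w \<Rightarrow> real) \<Rightarrow> 'w set \<Rightarrow> real measure" where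
  "posterior M S H = distr (uniform_measure M H) borel S"

text \<open>
  For an event of positive probability, \<open>uniform_measure\<close> is conditioning on that event, so
  \<open>posterior\<close> is the usual conditional law \<open>A \<mapsto> P(S \<in> A, H) / P(H)\<close>.
\<close>

lemma measure_posterior:
  assumes "prob_space M" "S \<in> borel_measurable M" "H \<in> sets M" "measure M H > 0" "A \<in> sets borel"
  shows "measure (posterior M S H) A = measure M ({w \<in> space M. S w \<in> A} \<inter> H) / measure M H"
proof -
  interpret prob_space M by fact
  have m: "S \<in> borel_measurable (uniform_measure M H)"
    using assms(2) by (simp add: measurable_def)
  have V: "S -` A \<inter> space M \<in> sets M"
    using assms by (auto intro: measurable_sets)
  have "measure (posterior M S H) A = measure (uniform_measure M H) (S -` A \<inter> space M)"
    unfolding posterior_def using m assms(5) by (simp add: measure_distr)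
  also have "\<dots> = measure M (H \<inter> (S -` A \<inter> space M)) / measure M H"
    using assms V by (intro measure_uniform_measure) (auto simp: emeasure_eq_measure)
  also have "H \<inter> (S -` A \<inter> space M) = {w \<in> space M. S w \<in> A} \<inter> H"
    by auto
  finally show ?thesis .
qed

end

theory Submission
  imports Defs
begin

text \<open>
  Integrating the conditional probability \<open>P(H | S) = S ^ n\<close> of the event \<open>H\<close> that all runs reach
  \<open>xstar\<close> over \<open>{S \<in> A}\<close> gives \<open>P(S \<in> A, H) = \<integral>\<^sub>A s ^ n d\<Pi>\<close>. Multiplying the \<open>Beta(\<alpha>, \<beta>)\<close> density by
  \<open>s ^ n\<close> gives a multiple of the \<open>Beta(\<alpha> + n, \<beta>)\<close> density, which is conjugacy.
  For the tail of \<open>Beta(a, b)\<close> with \<open>a \<ge> 1\<close>, bound \<open>s powr (a - 1)\<close> by \<open>(1 - \<epsilon>) powr (a - 1)\<close>, integrate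
  \<open>(1 - s) powr (b - 1)\<close>, and estimate \<open>\<Gamma>(a + b) / \<Gamma>(a) \<le> (a + b) powr b\<close> by log-convexity of \<open>\<Gamma>\<close>.
\<close>

section \<open>Beta densities and conjugacy with the likelihood \<open>s ^ n\<close>\<close>

lemma Beta_real_pos:
  fixes a b :: real
  assumes "a > 0" "b > 0"
  shows "Beta a b > 0"
  using assms by (simp add: Beta_def Gamma_real_pos)

lemma beta_density_measurable [measurable]: "beta_density a b \<in> borel_measurable borel"
  unfolding beta_density_def by measurable

lemma beta_density_nonneg:
  assumes "a > 0" "b > 0"
  shows "beta_density a b s \<ge> 0"
  using Beta_real_pos[OF assms] by (simp add: beta_density_def)

text \<open>The factor \<open>s ^ n\<close> only shifts the exponent of \<open>s\<close>; the
  quotient of Beta functions exchanges the normalising constants. Off the open unit interval both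
  densities vanish.\<close>

lemma beta_density_power_mult:
  assumes "a > 0" "b > 0"
  shows "beta_density a b s * s ^ n =
    Beta (a + real n) b / Beta a b * beta_density (a + real n) b s"
proof (cases "0 < s \<and> s < 1")
  case True
  then have "s powr (a - 1) * s ^ n = s powr (a + real n - 1)"
    using powr_add[of s "a - 1" "real n"] by (simp add: powr_realpow algebra_simps)
  then show ?thesis
    using True Beta_real_pos[of a b] Beta_real_pos[of "a + real n" b] assms
    by (simp add: beta_density_def field_simps)
qed (auto simp: beta_density_def)

lemma set_integral_beta_measure:
  fixes f :: "real \<Rightarrow> real"
  assumes "a > 0" "b > 0" "A \<in> sets borel" "f \<in> borel_measurable borel"
  shows "(LINT s:A|beta_measure a b. f s) = (LINT s:A|lborel. beta_density a b s * f s)"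
  using assms unfolding set_lebesgue_integral_def beta_measure_def
  by (subst integral_density) (auto simp: beta_density_nonneg mult_ac)

lemma measure_beta_measure:
  assumes "a > 0" "b > 0" "A \<in> sets borel"
  shows "measure (beta_measure a b) A = (LINT s:A|lborel. beta_density a b s)"
proof -
  have "measure (beta_measure a b) A = (LINT s:A|beta_measure a b. 1)"
    by (simp add: set_lebesgue_integral_def beta_measure_def)
  then show ?thesis
    using assms by (simp add: set_integral_beta_measure)
qed

text \<open>The prefactor does not depend on \<open>A\<close>, so it cancels when the posterior is
  normalised.\<close>

lemma set_integral_power_beta_measure:
  assumes "a > 0" "b > 0" "A \<in> sets borel"
  shows "(LINT s:A|beta_measure a b. s ^ n) =
    Beta (a + real n) b / Beta a b * measure (beta_measure (a + real n) b) A"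
  using assms
  by (simp add: set_integral_beta_measure measure_beta_measure beta_density_power_mult)

lemma measure_beta_measure_unit_interval:
  assumes "a > 0" "b > 0"
  shows "measure (beta_measure a b) {0..1} = 1"
proof -
  interpret prob_space "beta_measure a b"
    using assms by (rule prob_space_beta_measure)
  have "measure (beta_measure a b) {0..1} = measure (beta_measure a b) UNIV"
    using assms
    by (auto simp: measure_beta_measure set_lebesgue_integral_def beta_density_def
        intro!: Bochner_Integration.integral_cong split: split_indicator)
  then show ?thesis
    using prob_space by (simp add: beta_measure_def)
qed

section \<open>Gamma quotients and the lower tail of a Beta law\<close>

text \<open>The slope of \<open>ln \<circ> \<Gamma>\<close> on \<open>[a, a + b]\<close> is at most its slope \<open>ln (a + b)\<close> on \<open>[a + b, a + b + 1]\<close>.\<close>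

lemma Gamma_add_le_powr:
  fixes a b :: real
  assumes "a > 0" "b > 0"
  shows "Gamma (a + b) \<le> (a + b) powr b * Gamma a"
proof -
  \<comment> \<open>This weight makes \<open>a + b\<close> the convex combination of
    \<open>a + b + 1\<close> and \<open>a\<close> with coefficients \<open>1 - t\<close> and
    \<open>t\<close>.\<close>
  define t where "t = 1 / (1 + b)"
  have t: "0 \<le> t" "t \<le> 1" "1 - t = b * t" "t > 0"
    using assms by (auto simp: t_def field_simps)
  have G: "Gamma a > 0" "Gamma (a + b) > 0"
    using assms by (auto intro: Gamma_real_pos)
  have *: "(1 - t) * (a + b + 1) + t * a = a + b"
    using assms unfolding t_def by (simp add: divide_simps) (simp add: algebra_simps)
  have "ln (Gamma (a + b)) \<le> (1 - t) * ln (Gamma (a + b + 1)) + t * ln (Gamma a)"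
    using convex_onD[OF log_convex_Gamma_real t(1,2), of "a + b + 1" a] assms *
    by simp
  also have "Gamma (a + b + 1) = (a + b) * Gamma (a + b)"
    using assms Gamma_plus1[of "a + b"] nonpos_Ints_nonpos[of "a + b"] by force
  also have "(1 - t) * ln ((a + b) * Gamma (a + b)) + t * ln (Gamma a) =
      t * (b * (ln (a + b) + ln (Gamma (a + b))) + ln (Gamma a))"
    using assms G ln_mult_pos[of "a + b" "Gamma (a + b)"]
    by (simp only: t(3)) (simp add: algebra_simps)
  \<comment> \<open>The factor \<open>t * (1 + b)\<close> equals 1; writing it on the left lets the
    positive \<open>t\<close> cancel from both sides.\<close>
  finally have "(t * (1 + b)) * ln (Gamma (a + b)) \<le>
      t * (b * (ln (a + b) + ln (Gamma (a + b))) + ln (Gamma a))"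
    using assms by (simp add: t_def)
  then have "(1 + b) * ln (Gamma (a + b)) \<le> b * (ln (a + b) + ln (Gamma (a + b))) + ln (Gamma a)"
    using t(4) by (simp only: mult.assoc mult_le_cancel_left_pos)
  then have "ln (Gamma (a + b)) \<le> b * ln (a + b) + ln (Gamma a)"
    by (simp add: algebra_simps)
  also have "\<dots> = ln ((a + b) powr b * Gamma a)"
    using assms G ln_mult_pos[of "(a + b) powr b" "Gamma a"] by (simp add: ln_powr)
  finally show ?thesis
    using assms G by simp
qed

text \<open>On the tail the density is dominated by a multiple of the Beta(1, \<open>b\<close>)
  density, whose total mass is 1, so no integral has to be computed. The condition
  \<open>a \<ge> 1\<close> makes \<open>s powr (a - 1)\<close> monotone.\<close>

lemma beta_measure_tail_le:
  assumes "a \<ge> 1" "b > 0" "0 < \<epsilon>" "\<epsilon> < 1"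
  shows "measure (beta_measure a b) {..1 - \<epsilon>} \<le>
    (a + b) powr b / Gamma (b + 1) * (1 - \<epsilon>) powr (a - 1)"
proof -
  interpret B: prob_space "beta_measure a b"
    using assms by (intro prob_space_beta_measure) auto
  interpret B1: prob_space "beta_measure 1 b"
    using assms by (intro prob_space_beta_measure) auto
  have G: "Gamma a > 0" "Gamma b > 0" "Gamma (b + 1) > 0"
    using assms by (auto intro: Gamma_real_pos)
  \<comment> \<open>The first factor bounds \<open>s powr (a - 1)\<close> on the tail, the second
    passes from one normalising constant to the other.\<close>
  define c where "c = (1 - \<epsilon>) powr (a - 1) * (Beta 1 b / Beta a b)"
  have Bpos: "Beta a b > 0" "Beta 1 b > 0"
    using assms by (auto intro: Beta_real_pos)
  have c: "c \<ge> 0"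
    using Bpos by (simp add: c_def)
  have le: "beta_density a b s * indicator {..1 - \<epsilon>} s \<le> c * beta_density 1 b s" for s
  proof (cases "0 < s \<and> s \<le> 1 - \<epsilon>")
    case True
    then have "s powr (a - 1) \<le> (1 - \<epsilon>) powr (a - 1)"
      using assms by (intro powr_mono2) auto
    then have "s powr (a - 1) * ((1 - s) powr (b - 1) / Beta a b) \<le>
        (1 - \<epsilon>) powr (a - 1) * ((1 - s) powr (b - 1) / Beta a b)"
      using Bpos by (intro mult_right_mono) auto
    then show ?thesis
      using True assms Bpos by (simp add: beta_density_def c_def)
  next
    case False
    then show ?thesis
      using mult_nonneg_nonneg[OF c beta_density_nonneg[of 1 b s]] assms
      by (auto simp: beta_density_def split: split_indicator)
  qed
  have "emeasure (beta_measure a b) {..1 - \<epsilon>} =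
      (\<integral>\<^sup>+ s. ennreal (beta_density a b s * indicator {..1 - \<epsilon>} s) \<partial>lborel)"
    unfolding beta_measure_def
    by (subst emeasure_density) (auto intro!: nn_integral_cong split: split_indicator)
  also have "\<dots> \<le> (\<integral>\<^sup>+ s. ennreal c * ennreal (beta_density 1 b s) \<partial>lborel)"
    using le c assms beta_density_nonneg[of 1 b]
    by (intro nn_integral_mono) (auto simp: ennreal_mult [symmetric] intro!: ennreal_leI)
  also have "\<dots> = ennreal c * emeasure (beta_measure 1 b) UNIV"
    unfolding beta_measure_def by (simp add: nn_integral_cmult emeasure_density)
  also have "\<dots> = ennreal c"
    using B1.emeasure_space_1 by (simp add: beta_measure_def)
  finally have "measure (beta_measure a b) {..1 - \<epsilon>} \<le> c"
    using c by (simp add: B.emeasure_eq_measure)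
  also have "Beta 1 b / Beta a b = Gamma (a + b) / Gamma a / Gamma (b + 1)"
  proof -
    have "Beta 1 b = Gamma b / Gamma (b + 1)"
      by (simp add: Beta_def add.commute)
    then show ?thesis
      using G by (simp add: Beta_def)
  qed
  then have "c = Gamma (a + b) / Gamma a / Gamma (b + 1) * (1 - \<epsilon>) powr (a - 1)"
    by (simp add: c_def)
  also have "\<dots> \<le> (a + b) powr b / Gamma (b + 1) * (1 - \<epsilon>) powr (a - 1)"
    using G assms Gamma_add_le_powr[of a b]
    by (intro mult_right_mono divide_right_mono) (simp_all add: divide_le_eq)
  finally show ?thesis .
qed

section \<open>Conditioning on the basin size\<close>

lemma subalgebra_gen_sigma:
  assumes "S \<in> borel_measurable M"
  shows "subalgebra M (gen_sigma M S)"
  using assms unfolding subalgebra_def gen_sigma_def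
  by (auto simp: sets_vimage_algebra2 intro: measurable_sets)

text \<open>For \<open>n = 0\<close> the intersection would be \<open>UNIV\<close>, which in general
  is not \<open>space M\<close>.\<close>

lemma all_reach_eq_Inter:
  assumes "n \<ge> 1"
  shows "all_reach M X x n = (\<Inter>i\<in>{..<n}. X i -` {x} \<inter> space M)"
proof -
  have "0 \<in> {..<n}"
    using assms by simp
  then show ?thesis
    unfolding all_reach_def by blast
qed

lemma sets_all_reach:
  assumes "n \<ge> 1" "{x} \<in> sets N" "\<And>i. i < n \<Longrightarrow> X i \<in> measurable M N"
  shows "all_reach M X x n \<in> sets M"
  unfolding all_reach_eq_Inter[OF assms(1)] using assms
  by (intro sets.finite_INT) (auto intro!: measurable_sets simp: lessThan_empty_iff)

text \<open>Conditional independence turns P(H | S) into a product of \<open>n\<close> factors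
  \<open>S\<close>. Integrating over the event that \<open>S\<close> lies in \<open>A\<close> and
  changing variables gives an integral against the law of \<open>S\<close>.\<close>

lemma measure_all_reach_Int:
  assumes "prob_space M" and S: "S \<in> borel_measurable M"
    and n: "n \<ge> 1" and x: "{x} \<in> sets N"
    and runs: "cond_indep_vars M (gen_sigma M S) N X {..<n}"
    and reach: "\<And>i. i < n \<Longrightarrow>
        AE w in M. real_cond_exp M (gen_sigma M S) (\<lambda>w. indicator {x} (X i w)) w = S w"
    and A: "A \<in> sets borel"
  shows "measure M ({w \<in> space M. S w \<in> A} \<inter> all_reach M X x n) =
      (LINT s:A|distr M borel S. s ^ n)"
proof -
  interpret prob_space M by fact
  interpret F: finite_measure_subalgebra M "gen_sigma M S"
    using subalgebra_gen_sigma[OF S] by unfold_locales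
  let ?F = "gen_sigma M S" and ?H = "all_reach M X x n" and ?V = "S -` A \<inter> space M"
  have X: "X i \<in> measurable M N" if "i < n" for i
    using runs that by (auto simp: cond_indep_vars_def)
  have H: "?H \<in> sets M"
    using n x X by (rule sets_all_reach)
  have "AE w in M. real_cond_exp M ?F (\<lambda>w. \<Prod>j<n. indicator {x} (X j w)) w
      = (\<Prod>j<n. real_cond_exp M ?F (\<lambda>w. indicator {x} (X j w)) w)"
    using runs x unfolding cond_indep_vars_def
    by (auto dest!: spec[of _ "{..<n}"] spec[of _ "\<lambda>_. {x}"])
  moreover have "AE w in M. \<forall>i\<in>{..<n}. real_cond_exp M ?F (\<lambda>w. indicator {x} (X i w)) w = S w"
    using reach by (intro AE_finite_allI) auto
  moreover have "AE w in M. real_cond_exp M ?F (\<lambda>w. \<Prod>j<n. indicator {x} (X j w)) w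
      = real_cond_exp M ?F (indicator ?H) w"
  proof (rule F.real_cond_exp_cong)
    show "AE w in M. (\<Prod>j<n. indicator {x} (X j w)) = (indicator ?H w :: real)"
      by (auto simp: all_reach_def indicator_def)
    show "(\<lambda>w. \<Prod>j<n. indicator {x} (X j w) :: real) \<in> borel_measurable M"
      using X x by (intro borel_measurable_prod measurable_compose[OF X]) auto
  qed (use H in measurable)
  ultimately have ae: "AE w in M. real_cond_exp M ?F (indicator ?H) w = S w ^ n"
    by eventually_elim simp
  \<comment> \<open>Membership in the generated sigma-algebra, not merely in \<open>sets M\<close>,
    is what allows the indicator of \<open>?H\<close> to be replaced by its conditional expectation
    under the integral over \<open>?V\<close>.\<close>
  have V: "?V \<in> sets ?F"
    using A unfolding gen_sigma_def by (rule in_vimage_algebra)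
  then have VM: "?V \<in> sets M"
    using F.subalg by (auto simp: subalgebra_def)
  have "measure M ({w \<in> space M. S w \<in> A} \<inter> ?H) = (LINT w:?V|M. indicator ?H w)"
  proof -
    have "(LINT w:?V|M. indicator ?H w :: real) = (LINT w|M. indicator (?V \<inter> ?H) w)"
      unfolding set_lebesgue_integral_def
      by (simp add: indicator_inter_arith)
    also have "?V \<inter> ?H \<inter> space M = {w \<in> space M. S w \<in> A} \<inter> ?H"
      by auto
    then have "(LINT w|M. indicator (?V \<inter> ?H) w) =
        measure M ({w \<in> space M. S w \<in> A} \<inter> ?H)"
      by simp
    finally show ?thesis by simp
  qed
  also have "\<dots> = (LINT w:?V|M. real_cond_exp M ?F (indicator ?H) w)"
    using V H by (intro F.real_cond_exp_intA integrable_real_indicator)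
      (auto simp: emeasure_eq_measure)
  also have "\<dots> = (LINT w:?V|M. S w ^ n)"
    unfolding set_lebesgue_integral_def
    using ae VM S by (intro integral_cong_AE) auto
  also have "\<dots> = (LINT s:A|distr M borel S. s ^ n)"
    unfolding set_lebesgue_integral_def using S A
    by (subst integral_distr) (auto intro!: Bochner_Integration.integral_cong split: split_indicator)
  finally show "measure M ({w \<in> space M. S w \<in> A} \<inter> ?H) = (LINT s:A|distr M borel S. s ^ n)" .
qed

section \<open>The posterior law and its concentration\<close>

theorem proposition5p1:
  fixes M :: "'w measure" and S :: "'w \<Rightarrow> real"
    and N :: "'x measure" and X :: "nat \<Rightarrow> 'w \<Rightarrow> 'x" and xstar :: 'x
    and \<alpha> \<beta> :: real and n :: nat
  assumes "\<alpha> > 0" and "\<beta> > 0" and "n \<ge> 1"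
    and "prob_space M"
    and "S \<in> borel_measurable M"
    and prior: "distr M borel S = beta_measure \<alpha> \<beta>"
    and "{xstar} \<in> sets N"
    and runs: "cond_indep_vars M (gen_sigma M S) N X {..<n}"
    and reach: "\<And>i. i < n \<Longrightarrow>
        AE w in M. real_cond_exp M (gen_sigma M S) (\<lambda>w. indicator {xstar} (X i w)) w = S w"
  shows "(\<forall>A\<in>sets borel. A \<subseteq> {0..1} \<longrightarrow>
            measure (posterior M S (all_reach M X xstar n)) A =
              (LINT s:A|beta_measure \<alpha> \<beta>. s ^ n) / (LINT s:{0..1}|beta_measure \<alpha> \<beta>. s ^ n))
       \<and> posterior M S (all_reach M X xstar n) = beta_measure (\<alpha> + real n) \<beta>
       \<and> (\<forall>\<epsilon>::real. 0 < \<epsilon> \<and> \<epsilon> < 1 \<longrightarrow>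
            measure (posterior M S (all_reach M X xstar n)) {s. s \<le> 1 - \<epsilon>}
              \<le> (\<alpha> + real n + \<beta>) powr \<beta> / Gamma (\<beta> + 1) * (1 - \<epsilon>) powr (\<alpha> + real n - 1))"
proof -
  interpret prob_space M by fact
  interpret B: prob_space "beta_measure (\<alpha> + real n) \<beta>"
    using assms(1,2) by (intro prob_space_beta_measure) auto
  let ?H = "all_reach M X xstar n"
  \<comment> \<open>This is the \<open>n\<close>-th moment of the prior; taking
    \<open>A = UNIV\<close> below identifies it with the probability of \<open>?H\<close>, whose
    positivity makes the conditioning meaningful.\<close>
  define r where "r = Beta (\<alpha> + real n) \<beta> / Beta \<alpha> \<beta>"
  note S = \<open>S \<in> borel_measurable M\<close>
  have H: "?H \<in> sets M"
    using \<open>n \<ge> 1\<close> \<open>{xstar} \<in> sets N\<close> runs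
    by (intro sets_all_reach) (auto simp: cond_indep_vars_def)
  have r: "r > 0"
    using assms(1,2) by (simp add: r_def Beta_real_pos)
  have int: "measure M ({w \<in> space M. S w \<in> A} \<inter> ?H) =
      r * measure (beta_measure (\<alpha> + real n) \<beta>) A" if "A \<in> sets borel" for A
    unfolding r_def set_integral_power_beta_measure[OF assms(1,2) that, symmetric] prior [symmetric]
    using \<open>prob_space M\<close> S \<open>n \<ge> 1\<close> \<open>{xstar} \<in> sets N\<close> runs reach that
    by (rule measure_all_reach_Int)
  have "{w \<in> space M. S w \<in> UNIV} \<inter> ?H = ?H"
    unfolding all_reach_def by blast
  then have mH: "measure M ?H = r"
    using int[of UNIV] B.prob_space unfolding beta_measure_def by simp
  have post: "measure (posterior M S ?H) A = measure (beta_measure (\<alpha> + real n) \<beta>) A"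
    if "A \<in> sets borel" for A
    using measure_posterior[OF \<open>prob_space M\<close> S H _ that] int[OF that] mH r by force
  \<comment> \<open>Equality of the real-valued \<open>measure\<close> lifts to
    \<open>emeasure\<close> only once both sides are known to be finite.\<close>
  have fin: "finite_measure (posterior M S ?H)"
  proof -
    have "prob_space (uniform_measure M ?H)"
      using r mH by (intro prob_space_uniform_measure) (auto simp: emeasure_eq_measure)
    moreover have "S \<in> borel_measurable (uniform_measure M ?H)"
      using S by (simp add: measurable_def)
    ultimately have "prob_space (posterior M S ?H)"
      unfolding posterior_def by (rule prob_space.prob_space_distr)
    then show ?thesis
      by (rule prob_space.finite_measure)
  qed
  have eq: "posterior M S ?H = beta_measure (\<alpha> + real n) \<beta>"
  proof (rule measure_eqI)
    show "sets (posterior M S ?H) = sets (beta_measure (\<alpha> + real n) \<beta>)"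
      by (simp add: posterior_def beta_measure_def)
    show "emeasure (posterior M S ?H) A = emeasure (beta_measure (\<alpha> + real n) \<beta>) A"
      if "A \<in> sets (posterior M S ?H)" for A
      unfolding finite_measure.emeasure_eq_measure[OF fin] B.emeasure_eq_measure
      using post[of A] that by (simp add: posterior_def)
  qed
  \<comment> \<open>Both integrals carry the factor \<open>r\<close>, and the one over
    \<open>{0..1}\<close> equals \<open>r\<close> because the updated Beta law gives that interval
    mass 1.\<close>
  have "measure (posterior M S ?H) A =
      (LINT s:A|beta_measure \<alpha> \<beta>. s ^ n) / (LINT s:{0..1}|beta_measure \<alpha> \<beta>. s ^ n)"
    if "A \<in> sets borel" for A
    using r measure_beta_measure_unit_interval[of "\<alpha> + real n" \<beta>] assms(1,2)
    unfolding eq set_integral_power_beta_measure[OF assms(1,2) that]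
      set_integral_power_beta_measure[OF assms(1,2) borel_closed[OF closed_atLeastAtMost]]
      r_def [symmetric]
    by simp
  moreover have "measure (posterior M S ?H) {s. s \<le> 1 - \<epsilon>} \<le>
      (\<alpha> + real n + \<beta>) powr \<beta> / Gamma (\<beta> + 1) * (1 - \<epsilon>) powr (\<alpha> + real n - 1)"
    if "0 < \<epsilon>" "\<epsilon> < 1" for \<epsilon> :: real
    using beta_measure_tail_le[of "\<alpha> + real n" \<beta> \<epsilon>] that assms(1-3)
    unfolding eq atMost_def by simp
  ultimately show ?thesis
    using eq by blast
qed

end
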